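(* Let $(X,\mathcal{A},\lambda)$ be a $\sigma$-finite measure space, let $T:X\to X$ be null-preserving, suppose that the system $(X,\mathcal{A},\lambda,T)$ is totally dissipative, and let $V\in\mathcal{A}$ be a wandering set. Then there exists a wandering set $W\in\mathcal{A}$ containing $V$ such that, writing $W_n:=\hat{T}^nW$ for $n\ge 0$ and $W_{-n}:=T^{-n}W$ for $n\ge 1$, one has $$X\overset{.}{=}\bigcup_{n\ge 0}T^{-n}W\ \cup\ \bigcup_{n\ge 1}\hat{T}^nW\ \overset{.}{=}\ \bigcup_{n\in\mathbb{Z}}W_n ,$$ and $$\hat{T}^mW_n\overset{.}{\subseteq}W_{n+m}\quad\text{and}\quad W_{n-m}\overset{.}{\subseteq}T^{-m}W_n\qquad\text{for all } m\ge 0,\ n\in\mathbb{Z}.$$ If moreover the system is nonsingular, then $\hat{T}^mW_n\overset{.}{=}W_{n+m}$ for all $m\ge 0$ and $n\in\mathbb{Z}$.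
   Context: For $A,B\in\mathcal{A}$ write $A\overset{.}{\subseteq}B$ if $\lambda(A\setminus B)=0$ and $A\overset{.}{=}B$ if $\lambda(A\triangle B)=0$. A measurable map $T:X\to X$ is null-preserving if $\lambda(A)=0$ implies $\lambda(T^{-1}A)=0$ for $A\in\mathcal{A}$. An essential image of $A\in\mathcal{A}$ under $T$ is a set $A'\in\mathcal{A}$ such that $T^{-1}A'\overset{.}{\supseteq}A$ and such that every $B'\in\mathcal{A}$ with $T^{-1}B'\overset{.}{\supseteq}A$ satisfies $B'\overset{.}{\supseteq}A'$. In the present ($\sigma$-finite, null-preserving) setting every $A\in\mathcal{A}$ has essential images and they form exactly one equivalence class under $\overset{.}{=}$; $\hat{T}A$ denotes an arbitrary fixed essential image of $A$, and $\hat{T}^n$ is the $n$-fold iterate ($\hat{T}^0A=A$). A set $W\in\mathcal{A}$ is wandering if $W\cap T^{-n}W\overset{.}{=}\varnothing$ for all $n\ge 1$. The system is totally dissipative if $X$ can be represented (up to a null-set) as a countable union of wandering sets. The system is nonsingular if $\lambda\circ T^{-1}$ and $\lambda$ are mutually absolutely continuous. *)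

theory Defs
  imports "HOL-Analysis.Analysis"
begin

definition ess_subset :: "'a measure \<Rightarrow> 'a set \<Rightarrow> 'a set \<Rightarrow> bool" where
  "ess_subset M A B \<longleftrightarrow> A - B \<in> null_sets M"

definition ess_eq :: "'a measure \<Rightarrow> 'a set \<Rightarrow> 'a set \<Rightarrow> bool" where
  "ess_eq M A B \<longleftrightarrow> (A - B) \<union> (B - A) \<in> null_sets M"

abbreviation preimg :: "'a measure \<Rightarrow> ('a \<Rightarrow> 'a) \<Rightarrow> nat \<Rightarrow> 'a set \<Rightarrow> 'a set" where
  "preimg M T n A \<equiv> (T ^^ n) -` A \<inter> space M"

definition null_preserving :: "'a measure \<Rightarrow> ('a \<Rightarrow> 'a) \<Rightarrow> bool" where
  "null_preserving M T \<longleftrightarrow> T \<in> measurable M M \<and>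
     (\<forall>A\<in>sets M. emeasure M A = 0 \<longrightarrow> emeasure M (T -` A \<inter> space M) = 0)"

definition nonsingular :: "'a measure \<Rightarrow> ('a \<Rightarrow> 'a) \<Rightarrow> bool" where
  "nonsingular M T \<longleftrightarrow> T \<in> measurable M M \<and>
     absolutely_continuous M (distr M M T) \<and> absolutely_continuous (distr M M T) M"

definition essential_image :: "'a measure \<Rightarrow> ('a \<Rightarrow> 'a) \<Rightarrow> 'a set \<Rightarrow> 'a set \<Rightarrow> bool" where
  "essential_image M T A A' \<longleftrightarrow> A' \<in> sets M \<and> ess_subset M A (T -` A' \<inter> space M) \<and>
     (\<forall>B'\<in>sets M. ess_subset M A (T -` B' \<inter> space M) \<longrightarrow> ess_subset M A' B')"

definition essential_image_map :: "'a measure \<Rightarrow> ('a \<Rightarrow> 'a) \<Rightarrow> ('a set \<Rightarrow> 'a set) \<Rightarrow> bool" where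
  "essential_image_map M T That \<longleftrightarrow> (\<forall>A\<in>sets M. essential_image M T A (That A))"

definition wandering :: "'a measure \<Rightarrow> ('a \<Rightarrow> 'a) \<Rightarrow> 'a set \<Rightarrow> bool" where
  "wandering M T W \<longleftrightarrow> W \<in> sets M \<and> (\<forall>n\<ge>1. ess_eq M (W \<inter> preimg M T n W) {})"

definition totally_dissipative :: "'a measure \<Rightarrow> ('a \<Rightarrow> 'a) \<Rightarrow> bool" where
  "totally_dissipative M T \<longleftrightarrow>
     (\<exists>\<W>. countable \<W> \<and> (\<forall>W\<in>\<W>. wandering M T W) \<and> ess_eq M (space M) (\<Union>\<W>))"

definition two_sided_orbit ::
  "'a measure \<Rightarrow> ('a \<Rightarrow> 'a) \<Rightarrow> ('a set \<Rightarrow> 'a set) \<Rightarrow> 'a set \<Rightarrow> int \<Rightarrow> 'a set" where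
  "two_sided_orbit M T That W n =
     (if n \<ge> 0 then (That ^^ nat n) W else preimg M T (nat (- n)) W)"

text \<open>Essential images always exist in the \<open>\<sigma>\<close>-finite null-preserving setting, so
  \<^const>\<open>essential_image_map\<close> is satisfiable: the support of the density of
  \<open>B \<mapsto> \<lambda> (A \<inter> T\<^sup>-\<^sup>1 B)\<close> with respect to \<open>\<lambda>\<close> is an essential image of \<open>A\<close>.\<close>

lemma essential_image_exists:
  assumes "sigma_finite_measure M" and np: "null_preserving M T" and A: "A \<in> sets M"
  shows "\<exists>A'. essential_image M T A A'"
proof -
  interpret sigma_finite_measure M by fact
  have T [measurable]: "T \<in> measurable M M"
    using np by (simp add: null_preserving_def)
  note A [measurable]
  define N where "N = distr (density M (indicator A)) M T"
  have N_eq: "emeasure N B = emeasure M (A \<inter> (T -` B \<inter> space M))" if [measurable]: "B \<in> sets M" for B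
  proof -
    have "T -` B \<inter> space M \<in> sets M" by measurable
    then show ?thesis
      by (simp add: N_def emeasure_distr emeasure_density mult.commute
          flip: indicator_inter_arith)
  qed
  have sets_N: "sets N = sets M" by (simp add: N_def)
  have "absolutely_continuous M N"
    unfolding absolutely_continuous_def
  proof
    fix B assume B: "B \<in> null_sets M"
    then have "T -` B \<inter> space M \<in> null_sets M"
      using np T by (auto simp: null_preserving_def null_sets_def)
    then have "A \<inter> (T -` B \<inter> space M) \<in> null_sets M"
      using A by (rule null_set_Int1)
    then show "B \<in> null_sets N"
      using B N_eq sets_N by (auto simp: null_sets_def)
  qed
  from Radon_Nikodym[OF this sets_N] obtain f where
    f [measurable]: "f \<in> borel_measurable M" and dens: "density M f = N" by blast
  define A' where "A' = {x \<in> space M. f x \<noteq> 0}"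
  have A' [measurable]: "A' \<in> sets M" unfolding A'_def by measurable
  have key: "ess_subset M A (T -` B \<inter> space M) \<longleftrightarrow> ess_subset M A' B" if B [measurable]: "B \<in> sets M" for B
  proof -
    have TB: "T -` B \<inter> space M \<in> sets M" by measurable
    have "A - (T -` B \<inter> space M) = A \<inter> (T -` (space M - B) \<inter> space M)"
      using sets.sets_into_space[OF A] measurable_space[OF T] by auto
    then have "ess_subset M A (T -` B \<inter> space M) \<longleftrightarrow> emeasure N (space M - B) = 0"
      using N_eq[of "space M - B"] A B TB by (auto simp: ess_subset_def null_sets_def)
    also have "\<dots> \<longleftrightarrow> space M - B \<in> null_sets (density M f)"
      using B by (auto simp: null_sets_def dens sets_N)
    also have "\<dots> \<longleftrightarrow> (AE x in M. x \<in> space M - B \<longrightarrow> f x = 0)"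
      using B by (subst null_sets_density_iff) auto
    also have "\<dots> \<longleftrightarrow> A' - B \<in> null_sets M"
      using B A' by (subst AE_iff_null_sets) (auto simp: A'_def intro!: AE_cong)
    finally show ?thesis by (simp add: ess_subset_def)
  qed
  have "ess_subset M A' A'" by (simp add: ess_subset_def)
  then have "essential_image M T A A'"
    unfolding essential_image_def using key A' by blast
  then show ?thesis ..
qed

corollary essential_image_map_exists:
  assumes "sigma_finite_measure M" and "null_preserving M T"
  shows "\<exists>That. essential_image_map M T That"
  unfolding essential_image_map_def
  by (rule bchoice) (use essential_image_exists[OF assms] in blast)

end

theory Submission
  imports Defs
begin

text \<open>
  Write \<open>A(V)\<close> for \<open>\<Union>n\<ge>0. T\<^sup>-\<^sup>n V\<close> together with the iterated essential images of \<open>V\<close>. If \<open>V\<close> and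
  \<open>U\<close> are wandering, then so is \<open>V \<union> (U - A(V))\<close>: the added part misses every \<open>T\<^sup>-\<^sup>n V\<close> by
  construction, and it is not reached from \<open>V\<close> because \<open>V\<close> lies essentially in the
  \<open>n\<close>-th preimage of its \<open>n\<close>-th essential image. Absorbing in turn the wandering sets of a
  countable cover of the space and taking the increasing union yields \<open>W\<close>.
\<close>

section \<open>Calculus of essential inclusion and essential equality\<close>

lemma ess_subset_refl [simp]: "ess_subset M A A"
  by (simp add: ess_subset_def)

lemma ess_subset_of_subset: "A \<subseteq> B \<Longrightarrow> ess_subset M A B"
  by (simp add: ess_subset_def Diff_eq_empty_iff[THEN iffD2])

lemma ess_eq_refl [simp]: "ess_eq M A A"
  by (simp add: ess_eq_def)

text \<open>Members of \<open>null_sets M\<close> are measurable, so a subset of a null set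
  qualifies only once its own measurability is known; this is why \<open>A\<close> and
  \<open>C\<close> are required to lie in \<open>sets M\<close>.\<close>

lemma ess_subset_trans:
  assumes "A \<in> sets M" "C \<in> sets M" "ess_subset M A B" "ess_subset M B C"
  shows "ess_subset M A C"
proof -
  have "(A - B) \<union> (B - C) \<in> null_sets M"
    using assms by (auto simp: ess_subset_def)
  moreover have "A - C \<in> sets M" using assms by auto
  ultimately show ?thesis
    unfolding ess_subset_def by (rule null_sets_subset) auto
qed

lemma ess_subset_UN:
  assumes "\<And>i. A i \<in> sets M" "B \<in> sets M" "\<And>i::nat. ess_subset M (A i) B"
  shows "ess_subset M (\<Union>i. A i) B"
proof -
  have "(\<Union>i. A i - B) \<in> null_sets M"
    using assms by (intro null_sets_UN) (auto simp: ess_subset_def)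
  then show ?thesis by (simp add: ess_subset_def)
qed

lemma ess_subset_Un:
  assumes "ess_subset M A C" "ess_subset M B C"
  shows "ess_subset M (A \<union> B) C"
  using assms by (auto simp: ess_subset_def Un_Diff)

lemma ess_eq_iff:
  assumes "A \<in> sets M" "B \<in> sets M"
  shows "ess_eq M A B \<longleftrightarrow> ess_subset M A B \<and> ess_subset M B A"
proof
  assume eq: "ess_eq M A B"
  show "ess_subset M A B \<and> ess_subset M B A"
    unfolding ess_subset_def using eq assms
    by (auto simp: ess_eq_def intro: null_sets_subset)
qed (auto simp: ess_eq_def ess_subset_def)

lemma wandering_iff_null:
  "wandering M T W \<longleftrightarrow> W \<in> sets M \<and> (\<forall>n\<ge>1. W \<inter> preimg M T n W \<in> null_sets M)"
  by (simp add: wandering_def ess_eq_def)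

lemma wandering_sets: "wandering M T W \<Longrightarrow> W \<in> sets M"
  by (simp add: wandering_def)

text \<open>Splits off the application of \<open>T\<close> made first;
  \<open>preimg_Suc_inner\<close> splits off the one made last. Both rest on \<open>T\<close>
  keeping points in \<open>space M\<close>, since every preimage is cut down to it.\<close>

lemma preimg_Suc:
  assumes "T \<in> measurable M M"
  shows "preimg M T (Suc n) A = T -` preimg M T n A \<inter> space M"
  using measurable_space[OF assms] by (auto simp: funpow_Suc_right simp del: funpow.simps)

lemma preimg_Suc_inner:
  assumes "T \<in> measurable M M"
  shows "preimg M T (Suc n) A = preimg M T n (T -` A \<inter> space M)"
proof -
  have "(T ^^ n) x \<in> space M" if "x \<in> space M" for x
    using that measurable_space[OF assms] by (induction n) auto
  then show ?thesis by auto
qed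

section \<open>Preimages and essential images under iteration\<close>

locale null_preserving_system =
  fixes M :: "'a measure" and T :: "'a \<Rightarrow> 'a" and That :: "'a set \<Rightarrow> 'a set"
  assumes np: "null_preserving M T"
    and image_map: "essential_image_map M T That"
begin

lemma T_measurable [measurable]: "T \<in> measurable M M"
  using np by (simp add: null_preserving_def)

lemma preimg_sets [measurable, simp]: "A \<in> sets M \<Longrightarrow> preimg M T n A \<in> sets M"
  by (rule measurable_sets[of _ M M]) (auto intro: measurable_compose_n)

lemma preimg_null:
  assumes "A \<in> null_sets M"
  shows "preimg M T n A \<in> null_sets M"
proof (induction n)
  case 0
  show ?case using assms by (simp add: null_sets.Int_space_eq2)
next
  case (Suc n)
  have "T -` preimg M T n A \<inter> space M \<in> null_sets M"
    using Suc np measurable_sets[OF T_measurable]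
    unfolding null_preserving_def null_sets_def by blast
  then show ?case by (simp only: preimg_Suc[OF T_measurable])
qed

lemma preimg_ess_mono:
  assumes "ess_subset M A B"
  shows "ess_subset M (preimg M T n A) (preimg M T n B)"
proof -
  have "preimg M T n A - preimg M T n B = preimg M T n (A - B)" by auto
  then show ?thesis
    using preimg_null[of "A - B" n] assms by (simp only: ess_subset_def)
qed

lemma essential_image_That: "A \<in> sets M \<Longrightarrow> essential_image M T A (That A)"
  using image_map by (simp add: essential_image_map_def)

lemma That_sets [simp]: "A \<in> sets M \<Longrightarrow> That A \<in> sets M"
  using essential_image_That by (auto simp: essential_image_def)

lemma preimg_That_sets: "A \<in> sets M \<Longrightarrow> T -` That A \<inter> space M \<in> sets M"
  by (rule measurable_sets[OF T_measurable That_sets])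

lemma That_pow_sets [simp]: "A \<in> sets M \<Longrightarrow> (That ^^ n) A \<in> sets M"
  by (induction n) auto

lemma ess_subset_preimg_That:
  "A \<in> sets M \<Longrightarrow> ess_subset M A (T -` That A \<inter> space M)"
  using essential_image_That by (auto simp: essential_image_def)

lemma That_ess_subset:
  assumes "A \<in> sets M" "B \<in> sets M" "ess_subset M A (T -` B \<inter> space M)"
  shows "ess_subset M (That A) B"
  using essential_image_That assms by (auto simp: essential_image_def)

text \<open>Minimality of \<open>That A\<close> is tested against \<open>That B\<close>, whose
  preimage essentially contains \<open>B\<close> and hence \<open>A\<close>.\<close>

lemma That_ess_mono:
  assumes "A \<in> sets M" "B \<in> sets M" "ess_subset M A B"
  shows "ess_subset M (That A) (That B)"
proof (rule That_ess_subset)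
  show "ess_subset M A (T -` That B \<inter> space M)"
    using assms(1,2)
    by (intro ess_subset_trans[OF _ _ assms(3) ess_subset_preimg_That] preimg_That_sets)
qed (use assms in simp_all)

lemma That_pow_ess_mono:
  assumes "A \<in> sets M" "B \<in> sets M" "ess_subset M A B"
  shows "ess_subset M ((That ^^ n) A) ((That ^^ n) B)"
  using assms by (induction n) (auto intro: That_ess_mono)

text \<open>Pulling the one-step inclusion for \<open>(That ^^ n) A\<close> back along
  \<open>T ^^ n\<close> lengthens the chain by one. In \<open>wandering_absorb\<close> this shows
  that almost every point of \<open>V\<close> is carried by \<open>T ^^ n\<close> into
  \<open>(That ^^ n) V\<close>.\<close>

lemma ess_subset_preimg_That_pow:
  assumes A: "A \<in> sets M"
  shows "ess_subset M A (preimg M T n ((That ^^ n) A))"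
proof (induction n)
  case 0
  show ?case using sets.sets_into_space[OF A] by (auto intro: ess_subset_of_subset)
next
  case (Suc n)
  have "ess_subset M A (preimg M T n (T -` That ((That ^^ n) A) \<inter> space M))"
    using A by (intro ess_subset_trans[OF _ _ Suc] preimg_ess_mono ess_subset_preimg_That
        preimg_sets preimg_That_sets That_pow_sets)
  then show ?case
    unfolding preimg_Suc_inner[OF T_measurable] by simp
qed

text \<open>The part of \<open>B\<close> outside the essential image has null preimage.
  Nonsingularity, in the direction \<open>absolutely_continuous (distr M M T) M\<close>, then makes
  that part itself null.\<close>

lemma nonsingular_ess_subset_That_preimg:
  assumes ns: "nonsingular M T" and B: "B \<in> sets M"
  shows "ess_subset M B (That (T -` B \<inter> space M))"
proof -
  let ?P = "T -` B \<inter> space M"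
  have P: "?P \<in> sets M" using B by measurable
  have "T -` (B - That ?P) \<inter> space M = ?P - (T -` That ?P \<inter> space M)" by auto
  also have "\<dots> \<in> null_sets M"
    using ess_subset_preimg_That[OF P] by (simp add: ess_subset_def)
  finally have "B - That ?P \<in> null_sets (distr M M T)"
    using B That_sets[OF P] by (simp add: null_sets_distr_iff sets.Diff)
  then show ?thesis
    using ns by (auto simp: nonsingular_def absolutely_continuous_def ess_subset_def)
qed

section \<open>The union of all preimages and iterated images of a set\<close>

definition orbit_union :: "'a set \<Rightarrow> 'a set" where
  "orbit_union W = (\<Union>n. preimg M T n W) \<union> (\<Union>n\<in>{1..}. (That ^^ n) W)"

text \<open>At index 0 the preimage and the image both equal \<open>W\<close>, so the image union
  may start at 0 as well, leaving one countable union over the naturals. The definition starts it at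
  1 to match the theorem literally.\<close>

lemma orbit_union_eq:
  assumes "W \<in> sets M"
  shows "orbit_union W = (\<Union>n. preimg M T n W \<union> (That ^^ n) W)"
proof -
  have "x \<in> (\<Union>n. preimg M T n W)" if "x \<in> W" for x
    using that sets.sets_into_space[OF assms] by (intro UN_I[of 0]) auto
  moreover have "x \<in> W \<or> x \<in> (\<Union>n\<in>{1..}. (That ^^ n) W)" if "x \<in> (That ^^ n) W" for x n
    using that by (cases n) (auto intro!: bexI[of _ n])
  ultimately show ?thesis
    unfolding orbit_union_def by fast
qed

lemma orbit_union_sets [simp]: "W \<in> sets M \<Longrightarrow> orbit_union W \<in> sets M"
  unfolding orbit_union_def by (intro sets.Un sets.countable_UN'') simp_all

lemma preimg_subset_orbit_union: "preimg M T n W \<subseteq> orbit_union W"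
  unfolding orbit_union_def by blast

lemma That_pow_subset_orbit_union: "W \<in> sets M \<Longrightarrow> (That ^^ n) W \<subseteq> orbit_union W"
  by (auto simp: orbit_union_eq)

lemma subset_orbit_union: "W \<in> sets M \<Longrightarrow> W \<subseteq> orbit_union W"
  using That_pow_subset_orbit_union[of W 0] by simp

text \<open>Carries what a stage of the construction already covers over to the limit set. As
  \<open>That\<close> is an arbitrary choice of essential images, even a true inclusion
  \<open>A \<subseteq> B\<close> gives only an essential one here.\<close>

lemma orbit_union_ess_mono:
  assumes "A \<in> sets M" "B \<in> sets M" "ess_subset M A B"
  shows "ess_subset M (orbit_union A) (orbit_union B)"
  unfolding orbit_union_eq[OF assms(1)]
proof (intro ess_subset_UN ess_subset_Un)
  fix n
  show "ess_subset M (preimg M T n A) (orbit_union B)"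
    using assms(1,2) by (intro ess_subset_trans[OF _ _ preimg_ess_mono[OF assms(3)]
          ess_subset_of_subset[OF preimg_subset_orbit_union]] preimg_sets orbit_union_sets)
  show "ess_subset M ((That ^^ n) A) (orbit_union B)"
    using assms(1,2) by (intro ess_subset_trans[OF _ _ That_pow_ess_mono[OF assms]
          ess_subset_of_subset[OF That_pow_subset_orbit_union]] That_pow_sets orbit_union_sets)
qed (use assms in \<open>auto intro!: sets.Un\<close>)

section \<open>Enlarging wandering sets\<close>

lemma wandering_absorb:
  assumes V: "wandering M T V" and U: "wandering M T U"
  shows "wandering M T (V \<union> (U - orbit_union V))"
proof -
  let ?B = "U - orbit_union V"
  have sets: "V \<in> sets M" "U \<in> sets M"
    using V U by (simp_all add: wandering_sets)
  have "(V \<union> ?B) \<inter> preimg M T n (V \<union> ?B) \<in> null_sets M" if n: "n \<ge> 1" for n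
  proof -
    \<comment> \<open>Three null sets suffice for the four cross terms, because \<open>?B\<close>
      misses \<open>preimg M T n V\<close> altogether. The last one handles \<open>V\<close> against
      the preimage of \<open>?B\<close>: if \<open>x\<close> is in \<open>V\<close> and its
      \<open>n\<close>-th iterate is in \<open>?B\<close>, that iterate lies outside
      \<open>(That ^^ n) V\<close>.\<close>
    let ?N = "(V \<inter> preimg M T n V) \<union> (U \<inter> preimg M T n U) \<union> (V - preimg M T n ((That ^^ n) V))"
    have "?N \<in> null_sets M"
      using V U n ess_subset_preimg_That_pow[OF sets(1), of n]
      by (intro null_sets.Un) (auto simp: wandering_iff_null ess_subset_def)
    moreover have "(V \<union> ?B) \<inter> preimg M T n (V \<union> ?B) \<in> sets M"
      by (intro sets.Int preimg_sets sets.Un sets.Diff orbit_union_sets sets)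
    moreover have "(V \<union> ?B) \<inter> preimg M T n (V \<union> ?B) \<subseteq> ?N"
      using preimg_subset_orbit_union[of n V] That_pow_subset_orbit_union[OF sets(1), of n] by auto
    ultimately show ?thesis by (rule null_sets_subset)
  qed
  then show ?thesis
    using sets by (simp add: wandering_iff_null sets.Un sets.Diff)
qed

text \<open>By monotonicity a point and its \<open>n\<close>-th iterate lie in a common stage, so
  the returning points form a countable union of the null sets belonging to the stages.\<close>

lemma wandering_incseq_UN:
  assumes "incseq V" and wand: "\<And>k. wandering M T (V k)"
  shows "wandering M T (\<Union>k. V k)"
proof -
  have "(\<Union>k. V k) \<inter> preimg M T n (\<Union>k. V k) \<in> null_sets M" if "n \<ge> 1" for n
  proof -
    have "(\<Union>k. V k) \<inter> preimg M T n (\<Union>k. V k) = (\<Union>k. V k \<inter> preimg M T n (V k))"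
    proof (intro equalityI subsetI)
      fix x assume "x \<in> (\<Union>k. V k) \<inter> preimg M T n (\<Union>k. V k)"
      then obtain i j where "x \<in> V i" "(T ^^ n) x \<in> V j" "x \<in> space M" by auto
      moreover have "V i \<subseteq> V (max i j)" "V j \<subseteq> V (max i j)"
        using incseqD[OF assms(1)] by auto
      ultimately show "x \<in> (\<Union>k. V k \<inter> preimg M T n (V k))" by blast
    qed auto
    also have "\<dots> \<in> null_sets M"
      using wand that by (intro null_sets_UN) (auto simp: wandering_iff_null)
    finally show ?thesis .
  qed
  moreover have "(\<Union>k. V k) \<in> sets M"
    using wand by (auto simp: wandering_iff_null)
  ultimately show ?thesis by (simp add: wandering_iff_null)
qed

lemma exists_generating_wandering_superset:
  assumes diss: "totally_dissipative M T" and V: "wandering M T V"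
  obtains W where "wandering M T W" "V \<subseteq> W" "ess_eq M (space M) (orbit_union W)"
proof -
  obtain \<W> where \<W>: "countable \<W>" "\<And>U. U \<in> \<W> \<Longrightarrow> wandering M T U" "ess_eq M (space M) (\<Union>\<W>)"
    using diss by (auto simp: totally_dissipative_def)
  \<comment> \<open>Inserting \<open>V\<close> makes the family nonempty, so that
    \<open>from_nat_into\<close> enumerates exactly this family even when the cover is empty;
    \<open>V\<close> is wandering too, so every \<open>U k\<close> still is.\<close>
  define U where "U = from_nat_into (insert V \<W>)"
  have range_U: "range U = insert V \<W>"
    unfolding U_def using \<W>(1) by (intro range_from_nat_into) auto
  have U: "wandering M T (U k)" for k
    using range_U \<W>(2) V by (metis insertE rangeI)
  define S where "S = rec_nat V (\<lambda>k A. A \<union> (U k - orbit_union A))"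
  have S_0: "S 0 = V" and S_Suc: "S (Suc k) = S k \<union> (U k - orbit_union (S k))" for k
    by (simp_all add: S_def)
  have S: "wandering M T (S k)" for k
    by (induction k) (auto simp: S_0 S_Suc V U intro: wandering_absorb)
  define W where "W = (\<Union>k. S k)"
  have inc: "incseq S" by (rule incseq_SucI) (auto simp: S_Suc)
  have W: "wandering M T W"
    unfolding W_def using inc S by (rule wandering_incseq_UN)
  have [simp]: "W \<in> sets M" "S k \<in> sets M" "U k \<in> sets M" for k
    by (rule wandering_sets, rule W S U)+
  have sets_UW: "U k \<in> sets M" "orbit_union W \<in> sets M" for k by simp_all
  have "ess_subset M (U k) (orbit_union W)" for k
  proof -
    \<comment> \<open>Each point of \<open>U k\<close> is either absorbed at stage
      \<open>Suc k\<close> or was already in the orbit union of stage \<open>k\<close>.\<close>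
    have "U k \<subseteq> S (Suc k) \<union> orbit_union (S k)" by (auto simp: S_Suc)
    moreover have "S (Suc k) \<subseteq> orbit_union W"
      using subset_orbit_union[OF \<open>W \<in> sets M\<close>] by (auto simp: W_def)
    moreover have "ess_subset M (orbit_union (S k)) (orbit_union W)"
      by (intro orbit_union_ess_mono ess_subset_of_subset) (auto simp: W_def)
    ultimately show ?thesis
      by (meson ess_subset_trans ess_subset_of_subset ess_subset_Un sets_UW)
  qed
  then have UN_U: "ess_subset M (\<Union>k. U k) (orbit_union W)"
    by (intro ess_subset_UN) auto
  have "(\<Union>\<W>) \<in> sets M"
    using \<W>(1,2) by (intro sets.countable_Union) (auto intro: wandering_sets)
  then have "ess_subset M (space M) (\<Union>\<W>)"
    using \<W>(3) by (simp add: ess_eq_iff)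
  moreover have "ess_subset M (\<Union>\<W>) (\<Union>k. U k)"
    using range_U by (intro ess_subset_of_subset) auto
  ultimately have "ess_subset M (space M) (\<Union>k. U k)"
    using ess_subset_trans[of "space M" M "\<Union>k. U k"] sets_UW(1) by blast
  then have "ess_subset M (space M) (orbit_union W)"
    using ess_subset_trans[OF _ _ _ UN_U] sets_UW(2) by blast
  moreover have "ess_subset M (orbit_union W) (space M)"
    by (intro ess_subset_of_subset sets.sets_into_space) simp
  ultimately have "ess_eq M (space M) (orbit_union W)" by (simp add: ess_eq_iff)
  moreover have "V \<subseteq> W" using S_0 by (auto simp: W_def)
  ultimately show thesis using W that by blast
qed

section \<open>The orbit indexed by the integers\<close>

abbreviation orbit :: "'a set \<Rightarrow> int \<Rightarrow> 'a set" where
  "orbit W n \<equiv> two_sided_orbit M T That W n"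

lemma orbit_of_nat: "orbit W (int n) = (That ^^ n) W"
  by (simp add: two_sided_orbit_def)

text \<open>At \<open>n = 0\<close> the definition takes the image branch and yields
  \<open>W\<close>; this agrees with \<open>preimg M T 0 W\<close> because \<open>W\<close> lies in
  the space.\<close>

lemma orbit_uminus_of_nat:
  assumes "W \<in> sets M"
  shows "orbit W (- int n) = preimg M T n W"
  using sets.sets_into_space[OF assms] by (cases "n = 0") (auto simp: two_sided_orbit_def)

lemma orbit_sets [simp]: "W \<in> sets M \<Longrightarrow> orbit W n \<in> sets M"
  by (simp add: two_sided_orbit_def)

lemma orbit_union_eq_UN_orbit:
  assumes "W \<in> sets M"
  shows "orbit_union W = (\<Union>n. orbit W n)"
proof (intro equalityI subsetI)
  fix x assume "x \<in> orbit_union W"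
  then obtain n where "x \<in> preimg M T n W \<or> x \<in> (That ^^ n) W"
    using assms by (auto simp: orbit_union_eq)
  then have "x \<in> orbit W (- int n) \<or> x \<in> orbit W (int n)"
    by (simp only: orbit_of_nat orbit_uminus_of_nat[OF assms])
  then show "x \<in> (\<Union>n. orbit W n)" by blast
next
  fix x assume "x \<in> (\<Union>n. orbit W n)"
  then show "x \<in> orbit_union W"
    using assms by (auto simp: two_sided_orbit_def orbit_union_eq split: if_splits)
qed

text \<open>The sign of \<open>n\<close> decides which alternative holds. The three step lemmas that
  follow treat each alternative separately: one is an equality, the other a property of essential
  images.\<close>

lemma orbit_step_cases:
  assumes "W \<in> sets M"
  shows "orbit W (n + 1) = That (orbit W n) \<or> orbit W n = T -` orbit W (n + 1) \<inter> space M"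
proof (cases "n \<ge> 0")
  case True
  then show ?thesis by (simp add: two_sided_orbit_def nat_add_distrib)
next
  case False
  \<comment> \<open>The shift by one makes \<open>n = -1\<close> correspond to \<open>k = 0\<close>,
    where the step ends at \<open>W\<close> itself, read as its preimage of index 0.\<close>
  define k where "k = nat (- n - 1)"
  have "n = - int (Suc k)" "n + 1 = - int k" using False by (simp_all add: k_def)
  then show ?thesis
    by (simp only: orbit_uminus_of_nat[OF assms] preimg_Suc[OF T_measurable] simp_thms)
qed

lemma That_orbit_step:
  assumes "W \<in> sets M"
  shows "ess_subset M (That (orbit W n)) (orbit W (n + 1))"
  using orbit_step_cases[OF assms, of n] That_ess_subset[of "orbit W n" "orbit W (n + 1)"] assms
  by auto

lemma preimg_orbit_step:
  assumes "W \<in> sets M"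
  shows "ess_subset M (orbit W n) (T -` orbit W (n + 1) \<inter> space M)"
  using orbit_step_cases[OF assms, of n] ess_subset_preimg_That[of "orbit W n"] assms
  by auto

text \<open>Nonsingularity acts on the negative indices, where the essential image of a preimage
  must recover the whole set.\<close>

lemma nonsingular_orbit_step:
  assumes "nonsingular M T" "W \<in> sets M"
  shows "ess_subset M (orbit W (n + 1)) (That (orbit W n))"
  using orbit_step_cases[OF assms(2), of n]
    nonsingular_ess_subset_That_preimg[OF assms(1), of "orbit W (n + 1)"] assms(2)
  by auto

lemma That_pow_orbit_ess_subset:
  assumes "W \<in> sets M"
  shows "ess_subset M ((That ^^ m) (orbit W n)) (orbit W (n + int m))"
proof (induction m)
  case (Suc m)
  have "ess_subset M (That ((That ^^ m) (orbit W n))) (That (orbit W (n + int m)))"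
    using Suc assms by (intro That_ess_mono) simp_all
  then have "ess_subset M (That ((That ^^ m) (orbit W n))) (orbit W (n + int m + 1))"
    using ess_subset_trans[OF _ _ _ That_orbit_step[OF assms]] assms by simp
  then show ?case by (simp add: ac_simps)
qed simp

lemma nonsingular_orbit_ess_subset_That_pow:
  assumes "nonsingular M T" "W \<in> sets M"
  shows "ess_subset M (orbit W (n + int m)) ((That ^^ m) (orbit W n))"
proof (induction m)
  case (Suc m)
  have "ess_subset M (That (orbit W (n + int m))) (That ((That ^^ m) (orbit W n)))"
    using Suc assms by (intro That_ess_mono) simp_all
  then have "ess_subset M (orbit W (n + int m + 1)) (That ((That ^^ m) (orbit W n)))"
    using ess_subset_trans[OF _ _ nonsingular_orbit_step[OF assms]] assms by simp
  then show ?case by (simp add: ac_simps)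
qed simp

lemma orbit_ess_subset_preimg:
  assumes "W \<in> sets M"
  shows "ess_subset M (orbit W (n - int m)) (preimg M T m (orbit W n))"
proof (induction m)
  case 0
  show ?case
    using sets.sets_into_space[OF orbit_sets[OF assms]] by (auto intro: ess_subset_of_subset)
next
  case (Suc m)
  have "ess_subset M (orbit W (n - int (Suc m))) (T -` orbit W (n - int m) \<inter> space M)"
    using preimg_orbit_step[OF assms, of "n - int (Suc m)"] by simp
  \<comment> \<open>Monotonicity is available for preimages under iterates; the case of
    \<open>T\<close> itself is the instance \<open>Suc 0\<close>.\<close>
  moreover have "ess_subset M (T -` orbit W (n - int m) \<inter> space M)
      (T -` preimg M T m (orbit W n) \<inter> space M)"
    using preimg_ess_mono[OF Suc, of "Suc 0"] by (simp only: funpow.simps comp_id)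
  moreover have "T -` preimg M T m (orbit W n) \<inter> space M \<in> sets M"
    using assms by (intro measurable_sets[OF T_measurable] preimg_sets orbit_sets)
  ultimately show ?case
    unfolding preimg_Suc[OF T_measurable]
    using ess_subset_trans[OF orbit_sets[OF assms]] by blast
qed

end

theorem theorem4p7:
  fixes M :: "'a measure" and T :: "'a \<Rightarrow> 'a" and That :: "'a set \<Rightarrow> 'a set" and V :: "'a set"
  assumes "sigma_finite_measure M"
    and "null_preserving M T"
    and "essential_image_map M T That"
    and "totally_dissipative M T"
    and "wandering M T V"
  shows "\<exists>W. wandering M T W \<and> V \<subseteq> W \<and>
    ess_eq M (space M) ((\<Union>n. preimg M T n W) \<union> (\<Union>n\<in>{1..}. (That ^^ n) W)) \<and>
    ess_eq M ((\<Union>n. preimg M T n W) \<union> (\<Union>n\<in>{1..}. (That ^^ n) W))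
      (\<Union>n. two_sided_orbit M T That W n) \<and>
    (\<forall>(m::nat) (n::int).
      ess_subset M ((That ^^ m) (two_sided_orbit M T That W n)) (two_sided_orbit M T That W (n + int m)) \<and>
      ess_subset M (two_sided_orbit M T That W (n - int m)) (preimg M T m (two_sided_orbit M T That W n))) \<and>
    (nonsingular M T \<longrightarrow>
      (\<forall>(m::nat) (n::int).
        ess_eq M ((That ^^ m) (two_sided_orbit M T That W n)) (two_sided_orbit M T That W (n + int m))))"
proof -
  interpret null_preserving_system M T That
    by standard (fact assms)+
  obtain W where W: "wandering M T W" "V \<subseteq> W" "ess_eq M (space M) (orbit_union W)"
    using exists_generating_wandering_superset assms(4,5) by blast
  note sets = wandering_sets[OF W(1)]
  show ?thesis
  proof (rule exI[of _ W], fold orbit_union_def, intro conjI allI impI)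
    \<comment> \<open>Here the two unions are equal as sets, not merely up to a null set.\<close>
    show "ess_eq M (orbit_union W) (\<Union>n. orbit W n)"
      by (simp add: orbit_union_eq_UN_orbit sets)
    show "ess_subset M ((That ^^ m) (orbit W n)) (orbit W (n + int m))"
      and "ess_subset M (orbit W (n - int m)) (preimg M T m (orbit W n))" for m n
      using sets by (rule That_pow_orbit_ess_subset orbit_ess_subset_preimg)+
    show "ess_eq M ((That ^^ m) (orbit W n)) (orbit W (n + int m))" if "nonsingular M T" for m n
      using that sets by (simp add: ess_eq_iff That_pow_orbit_ess_subset
          nonsingular_orbit_ess_subset_That_pow)
  qed (fact W)+
qed

end
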